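(* Let $G=(V,E,\omega)\in\mathbb{G}_\pi$ and let $\mathcal{V}$ be any nonempty subset of $V$. Then $\mathcal{BW}_\Gamma(\mathcal{R}_{\mathcal{V}}[G])\subseteq\mathcal{BW}_\Gamma(G)$.
   Context: Let $\mathbb{W}$ be the field of rational functions $p/q$ with $p,q\in\mathbb{C}[\lambda]$, $q\neq 0$, always written in lowest terms (zero is written $0/1$). $\mathbb{G}$ is the set of finite weighted digraphs $G=(V,E,\omega)$, loops allowed, no parallel edges, with $\omega:E\to\mathbb{W}$ and the convention $\omega(e)=0$ iff $e\notin E$; $\mathbb{G}^n$ is the set of those with $n$ vertices. Write $V=\{v_1,\dots,v_n\}$, $e_{ij}=(v_i,v_j)$, and let $M(G)\in\mathbb{W}^{n\times n}$, $M(G)_{ij}=\omega(e_{ij})$, be the weighted adjacency matrix. $\mathbb{G}_\pi^n\subset\mathbb{G}^n$ is the set of graphs all of whose weights are of the form $p/q$ with $\deg(p)\leq\deg(q)$ (the zero weight is allowed), and $\mathbb{G}_\pi=\bigcup_{n\ge1}\mathbb{G}_\pi^n$. Polynomial extension: for $G\in\mathbb{G}^n$ with $M(G)_{ij}=p_{ij}/q_{ij}$ let $L_i(G)=\prod_{j=1}^n q_{ij}$. The graph $\bar G$ has adjacency matrix $M(\bar G)_{ij}=L_i(G)M(G)_{ij}$ for $i\ne j$ and $M(\bar G)_{ii}=L_i(G)(M(G)_{ii}-\lambda)+\lambda$; its entries are polynomials in $\lambda$, so it may be evaluated at any $\lambda\in\mathbb{C}$. Put $r_i(\bar G)=\sum_{j\ne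 i}|M(\bar G)_{ij}|$ (a function of $\lambda\in\mathbb{C}$). Gershgorin-type region: $\mathcal{BW}_\Gamma(G)=\bigcup_{i=1}^n\{\lambda\in\mathbb{C}:|\lambda-M(\bar G)_{ii}|\le r_i(\bar G)\}$. Isospectral reduction: a nonempty $S\subseteq V$ is a structural set of $G$ if every cycle of $G$ that is not a loop contains a vertex of $S$, and $\omega(e_{ii})\ne\lambda$ for every $v_i\in V\setminus S$. For $v_i,v_j\in S$, a branch from $v_i$ to $v_j$ is a sequence of vertices $u_1=v_i,u_2,\dots,u_m=v_j$ ($m\ge2$) with $(u_k,u_{k+1})\in E$ for all $k$, all vertices distinct except that $u_1=u_m$ when $i=j$, and interior vertices $u_2,\dots,u_{m-1}\notin S$; its branch product is $\omega(u_1,u_2)\prod_{k=2}^{m-1}\frac{\omega(u_k,u_{k+1})}{\lambda-\omega(u_k,u_k)}$. The reduction $\mathcal{R}_S(G)$ is the graph with vertex set $S$ whose edge $(v_i,v_j)$ has weight equal to the sum of the branch products of all branches from $v_i$ to $v_j$ (no edge if this is $0$). A sequence of reductions on $G$ with final vertex set $\mathcal V$ is a sequence $S_1,\dots,S_m=\mathcal V$ with $S_1$ a structural set of $G$, $\mathcal{R}_1=\mathcal{R}_{S_1}(G)$, $S_{i+1}$ a structural set of $\mathcal{R}_i$, and $\mathcal{R}_{i+1}=\mathcal{R}_{S_{i+1}}(\mathcal{R}_i)$. It is known that for $G\in\mathbb{G}_\pi$ and any nonempty $\mathcal{V}\subseteq V$ such a sequence exists and that the final graph $\mathcal{R}_m$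 depends only on $\mathcal{V}$; it is denoted $\mathcal{R}_{\mathcal{V}}[G]$. *)

theory Defs
  imports
    Complex_Main
    "HOL-Computational_Algebra.Polynomial_Factorial"
    "HOL-Computational_Algebra.Field_as_Ring"
begin

(* The field W of rational functions is "complex poly fract".  "quot_of_fract" yields the
   lowest-terms representation p/q with monic denominator; in particular 0 is 0/1. *)

type_synonym ratfun = "complex poly fract"

abbreviation ratfun_num :: "ratfun \<Rightarrow> complex poly" where
  "ratfun_num f \<equiv> fst (quot_of_fract f)"

abbreviation ratfun_den :: "ratfun \<Rightarrow> complex poly" where
  "ratfun_den f \<equiv> snd (quot_of_fract f)"

definition lam :: ratfun where
  "lam = to_fract [:0, 1:]"

(* Only applied to weights that are polynomials, see polynomial_extension_is_poly. *)

definition ratfun_eval :: "ratfun \<Rightarrow> complex \<Rightarrow> complex" where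
  "ratfun_eval f z = poly (ratfun_num f) z / poly (ratfun_den f) z"

lemma ratfun_eval_to_fract: "ratfun_eval (to_fract p) z = poly p z"
  by (simp add: ratfun_eval_def)


(* By the convention that an edge is absent iff its weight is 0, the weight function also
   determines the edge set; M(G) is the weight function restricted to the vertices. *)

record 'v wdigraph =
  verts :: "'v set"
  weight :: "'v \<Rightarrow> 'v \<Rightarrow> ratfun"

definition edges :: "'v wdigraph \<Rightarrow> ('v \<times> 'v) set" where
  "edges G = {(u, v). weight G u v \<noteq> 0}"

definition wdigraphs :: "'v wdigraph set" where
  "wdigraphs = {G. finite (verts G) \<and> verts G \<noteq> {} \<and> edges G \<subseteq> verts G \<times> verts G}"

definition wdigraphs_pi :: "'v wdigraph set" where
  "wdigraphs_pi = {G \<in> wdigraphs. \<forall>u\<in>verts G. \<forall>v\<in>verts G.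
     degree (ratfun_num (weight G u v)) \<le> degree (ratfun_den (weight G u v))}"


definition row_den :: "'v wdigraph \<Rightarrow> 'v \<Rightarrow> complex poly" where
  "row_den G i = (\<Prod>j\<in>verts G. ratfun_den (weight G i j))"

definition polynomial_extension :: "'v wdigraph \<Rightarrow> 'v wdigraph" where
  "polynomial_extension G =
     \<lparr> verts = verts G,
       weight = (\<lambda>i j.
         if i \<in> verts G \<and> j \<in> verts G then
           if i = j then to_fract (row_den G i) * (weight G i i - lam) + lam
           else to_fract (row_den G i) * weight G i j
         else 0) \<rparr>"

lemma polynomial_extension_is_poly:
  assumes "G \<in> wdigraphs"
  shows "\<exists>p. weight (polynomial_extension G) i j = to_fract p"
proof (cases "i \<in> verts G \<and> j \<in> verts G")
  case True
  define q where "q = ratfun_den (weight G i j)"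
  define r where "r = (\<Prod>k\<in>verts G - {j}. ratfun_den (weight G i k))"
  have fin: "finite (verts G)"
    using assms by (simp add: wdigraphs_def)
  have L: "row_den G i = q * r"
    using True fin unfolding row_den_def q_def r_def by (intro prod.remove) auto
  have w: "weight G i j = to_fract (ratfun_num (weight G i j)) / to_fract q"
    by (metis Fract_conv_to_fract Fract_quot_of_fract q_def)
  have "to_fract q \<noteq> 0"
    by (simp add: q_def)
  then have "to_fract q * weight G i j = to_fract (ratfun_num (weight G i j))"
    by (subst w) simp
  then have *: "to_fract (row_den G i) * weight G i j =
      to_fract (r * ratfun_num (weight G i j))"
    by (simp add: L mult_ac)
  show ?thesis
  proof (cases "i = j")
    case True
    then have "weight (polynomial_extension G) i j =
        to_fract (r * ratfun_num (weight G i j) - row_den G i * [:0, 1:] + [:0, 1:])"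
      using \<open>i \<in> verts G \<and> j \<in> verts G\<close> *
      unfolding polynomial_extension_def lam_def
      by (simp only: wdigraph.simps to_fract_add to_fract_diff to_fract_mult
          right_diff_distrib if_True simp_thms)
    then show ?thesis by blast
  next
    case False
    then have "weight (polynomial_extension G) i j = to_fract (r * ratfun_num (weight G i j))"
      using \<open>i \<in> verts G \<and> j \<in> verts G\<close> * by (simp add: polynomial_extension_def)
    then show ?thesis by blast
  qed
next
  case False
  then have "weight (polynomial_extension G) i j = to_fract 0"
    by (auto simp: polynomial_extension_def)
  then show ?thesis by blast
qed

definition gersh_radius :: "'v wdigraph \<Rightarrow> 'v \<Rightarrow> complex \<Rightarrow> real" where
  "gersh_radius G i z = (\<Sum>j\<in>verts G - {i}. cmod (ratfun_eval (weight G i j) z))"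

definition BW_Gamma :: "'v wdigraph \<Rightarrow> complex set" where
  "BW_Gamma G = (\<Union>i\<in>verts G.
     {z. cmod (z - ratfun_eval (weight (polynomial_extension G) i i) z)
           \<le> gersh_radius (polynomial_extension G) i z})"


(* A cycle is listed without repeating its first vertex. *)

definition is_nonloop_cycle :: "'v wdigraph \<Rightarrow> 'v list \<Rightarrow> bool" where
  "is_nonloop_cycle G us \<longleftrightarrow>
     2 \<le> length us \<and> distinct us \<and>
     (\<forall>k < length us - 1. (us ! k, us ! Suc k) \<in> edges G) \<and>
     (last us, hd us) \<in> edges G"

definition structural_set :: "'v wdigraph \<Rightarrow> 'v set \<Rightarrow> bool" where
  "structural_set G S \<longleftrightarrow>
     S \<noteq> {} \<and> S \<subseteq> verts G \<and>
     (\<forall>us. is_nonloop_cycle G us \<longrightarrow> set us \<inter> S \<noteq> {}) \<and>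
     (\<forall>v\<in>verts G - S. weight G v v \<noteq> lam)"

(* Branches u_1, ..., u_m are lists with indices 0, ..., m - 1, so the interior indices
   are 1, ..., m - 2.  A branch from i to i repeats exactly its end point. *)

definition branches :: "'v wdigraph \<Rightarrow> 'v set \<Rightarrow> 'v \<Rightarrow> 'v \<Rightarrow> 'v list set" where
  "branches G S i j = {us.
     2 \<le> length us \<and> hd us = i \<and> last us = j \<and>
     (\<forall>k < length us - 1. (us ! k, us ! Suc k) \<in> edges G) \<and>
     (if i = j then distinct (butlast us) else distinct us) \<and>
     (\<forall>k \<in> {1..<length us - 1}. us ! k \<notin> S)}"

definition branch_product :: "'v wdigraph \<Rightarrow> 'v list \<Rightarrow> ratfun" where
  "branch_product G us =
     weight G (us ! 0) (us ! 1) *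
     (\<Prod>k\<in>{1..<length us - 1}.
        weight G (us ! k) (us ! Suc k) / (lam - weight G (us ! k) (us ! k)))"

definition isospectral_reduction :: "'v wdigraph \<Rightarrow> 'v set \<Rightarrow> 'v wdigraph" where
  "isospectral_reduction G S =
     \<lparr> verts = S,
       weight = (\<lambda>i j.
         if i \<in> S \<and> j \<in> S then \<Sum>us\<in>branches G S i j. branch_product G us else 0) \<rparr>"

(* The sum above ranges over a finite set for every graph. *)

lemma finite_branches:
  assumes "G \<in> wdigraphs"
  shows "finite (branches G S i j)"
proof (rule finite_subset)
  have fin: "finite (verts G)" and E: "edges G \<subseteq> verts G \<times> verts G"
    using assms by (auto simp: wdigraphs_def)
  show "finite {us. set us \<subseteq> verts G \<and> length us \<le> Suc (card (verts G))}"
    using fin by (rule finite_lists_length_le)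
  show "branches G S i j \<subseteq> {us. set us \<subseteq> verts G \<and> length us \<le> Suc (card (verts G))}"
  proof
    fix us assume "us \<in> branches G S i j"
    then have len: "2 \<le> length us"
      and ed: "\<And>k. k < length us - 1 \<Longrightarrow> (us ! k, us ! Suc k) \<in> edges G"
      and d: "distinct (butlast us)"
      by (auto simp: branches_def distinct_butlast split: if_splits)
    have "us ! k \<in> verts G" if "k < length us" for k
    proof (cases "k < length us - 1")
      case True
      then show ?thesis using ed E by blast
    next
      case False
      then have "k = Suc (k - 1)" "k - 1 < length us - 1"
        using that len by auto
      then show ?thesis using ed[of "k - 1"] E by auto
    qed
    then have sub: "set us \<subseteq> verts G"
      by (auto simp: in_set_conv_nth)
    have "set (butlast us) \<subseteq> verts G"
      using sub by (auto dest: in_set_butlastD)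
    then have "length (butlast us) \<le> card (verts G)"
      using d fin by (metis card_mono distinct_card)
    then show "us \<in> {us. set us \<subseteq> verts G \<and> length us \<le> Suc (card (verts G))}"
      using sub by auto
  qed
qed


fun reduction_sequence :: "'v wdigraph \<Rightarrow> 'v set list \<Rightarrow> bool" where
  "reduction_sequence G [] \<longleftrightarrow> True"
| "reduction_sequence G (S # Ss) \<longleftrightarrow>
     structural_set G S \<and> reduction_sequence (isospectral_reduction G S) Ss"

definition final_reduction :: "'v wdigraph \<Rightarrow> 'v set list \<Rightarrow> 'v wdigraph" where
  "final_reduction G Ss = foldl isospectral_reduction G Ss"

(* For G in wdigraphs_pi and nonempty V contained in verts G such a sequence exists and
   all of them end in the same graph, so that the description is then proper. *)

definition reduction_onto :: "'v wdigraph \<Rightarrow> 'v set \<Rightarrow> 'v wdigraph" where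
  "reduction_onto G V = (THE H. \<exists>Ss. Ss \<noteq> [] \<and> last Ss = V \<and>
     reduction_sequence G Ss \<and> H = final_reduction G Ss)"

end

theory Submission
  imports Defs
begin

text \<open>
  Reducing \<open>G\<close> over \<open>S\<close> eliminates the unknowns outside \<open>S\<close> from the eigenvalue equations
  \<open>\<lambda> x\<^sub>v = \<Sum>\<^sub>j M(G)\<^sub>v\<^sub>j x\<^sub>j\<close>. This elimination property is transitive and determines the reduced
  graph, so the order of reductions is irrelevant and one may remove one vertex \<open>v\<close> at a time,
  with \<open>w'\<^sub>i\<^sub>j = w\<^sub>i\<^sub>j + w\<^sub>i\<^sub>v w\<^sub>v\<^sub>j / (\<lambda> - w\<^sub>v\<^sub>v)\<close>. If rows \<open>i\<close> and \<open>v\<close> are both strictly diagonally dominant at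
  \<open>\<lambda>\<close>, so is row \<open>i\<close> after the removal. Points where weights have poles obey the same argument: the
  polynomial extension puts a pole of an off-diagonal weight into the region, while a pole of \<open>w\<^sub>i\<^sub>i\<close>
  alone counts as dominance with \<open>1 / (\<lambda> - w\<^sub>i\<^sub>i) = 0\<close>.
\<close>

section \<open>Evaluation and degree of rational functions\<close>

lemma ratfun_quotient: "f = to_fract (ratfun_num f) / to_fract (ratfun_den f)"
  by (metis Fract_conv_to_fract Fract_quot_of_fract)

text \<open>Cross-multiplication and coprimality of the lowest-terms pair show that
  \<open>ratfun_den f\<close> divides \<open>q\<close>, and the same cofactor relates the
  numerators. This lets poles, values and degrees be read off from any representing
  fraction.\<close>

lemma ratfun_cancel:
  fixes f :: ratfun
  assumes f: "f = to_fract p / to_fract q" and q: "q \<noteq> 0"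
  obtains d where "d \<noteq> 0" "p = ratfun_num f * d" "q = ratfun_den f * d"
proof -
  let ?n = "ratfun_num f" and ?d = "ratfun_den f"
  have d0: "?d \<noteq> 0" by simp
  have "to_fract ?n / to_fract ?d = to_fract p / to_fract q"
    using f ratfun_quotient[of f] by simp
  then have "to_fract (?n * q) = to_fract (p * ?d)"
    using q d0 by (simp add: frac_eq_eq)
  then have cross: "?n * q = p * ?d"
    by (simp only: to_fract_eq_iff)
  have cop: "coprime ?d ?n"
    using coprime_quot_of_fract[of f] by (simp add: coprime_commute)
  have "?d dvd ?n * q" using cross by simp
  with cop have "?d dvd q" by (simp add: coprime_dvd_mult_right_iff)
  then obtain d where d: "q = ?d * d" by blast
  from cross have "?d * (?n * d) = ?d * p" by (simp add: d mult_ac)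
  then have "p = ?n * d" using d0 by (metis mult_left_cancel)
  with d q show ?thesis by (intro that[of d]) auto
qed

text \<open>In lowest terms a zero of the denominator is a genuine pole. There
  \<open>ratfun_eval\<close> takes the default value 0 of division by zero, so the laws for sums and
  products are stated at regular points.\<close>

definition regular_at :: "ratfun \<Rightarrow> complex \<Rightarrow> bool" where
  "regular_at f z \<longleftrightarrow> poly (ratfun_den f) z \<noteq> 0"

text \<open>The cancelled factor divides \<open>q\<close>, so it cannot vanish at \<open>z\<close>
  when \<open>q\<close> does not.\<close>

lemma regular_at_quotient:
  fixes f :: ratfun
  assumes f: "f = to_fract p / to_fract q" and q: "poly q z \<noteq> 0"
  shows "regular_at f z" and "ratfun_eval f z = poly p z / poly q z"
proof -
  from q have "q \<noteq> 0" by auto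
  with f obtain d where "p = ratfun_num f * d" "q = ratfun_den f * d"
    by (rule ratfun_cancel)
  with q show "regular_at f z" "ratfun_eval f z = poly p z / poly q z"
    unfolding regular_at_def ratfun_eval_def
    by (metis mult_eq_0_iff poly_mult, metis mult_eq_0_iff poly_mult mult_divide_mult_cancel_right)
qed

lemma
  assumes "regular_at f z" "regular_at g z"
  shows regular_at_add: "regular_at (f + g) z"
    and ratfun_eval_add: "ratfun_eval (f + g) z = ratfun_eval f z + ratfun_eval g z"
proof -
  let ?q = "ratfun_den f * ratfun_den g"
  let ?p = "ratfun_num f * ratfun_den g + ratfun_num g * ratfun_den f"
  have "f + g = to_fract ?p / to_fract ?q"
    by (subst ratfun_quotient[of f], subst ratfun_quotient[of g]) (simp add: add_frac_eq)
  moreover have "poly ?q z \<noteq> 0"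
    using assms by (simp add: regular_at_def)
  ultimately show "regular_at (f + g) z"
    "ratfun_eval (f + g) z = ratfun_eval f z + ratfun_eval g z"
    using assms regular_at_quotient[of "f + g" ?p ?q z]
    by (simp_all add: ratfun_eval_def regular_at_def add_frac_eq)
qed

lemma regular_at_uminus:
  assumes "regular_at f z"
  shows "regular_at (- f) z"
proof (rule regular_at_quotient)
  show "- f = to_fract (- ratfun_num f) / to_fract (ratfun_den f)"
    by (subst ratfun_quotient[of f]) simp
  show "poly (ratfun_den f) z \<noteq> 0" using assms by (simp add: regular_at_def)
qed

text \<open>For one direction \<open>- g\<close> is added back to \<open>f + g\<close>. This later
  carries regularity of a loop weight from the reduced graph back to the original one.\<close>

lemma regular_at_add_iff:
  assumes "regular_at g z"
  shows "regular_at (f + g) z \<longleftrightarrow> regular_at f z"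
  using regular_at_add[of f z g] regular_at_add[of "f + g" z "- g"] regular_at_uminus[OF assms] assms
  by auto

lemma
  assumes "regular_at f z" "regular_at g z"
  shows regular_at_mult: "regular_at (f * g) z"
    and ratfun_eval_mult: "ratfun_eval (f * g) z = ratfun_eval f z * ratfun_eval g z"
proof -
  let ?q = "ratfun_den f * ratfun_den g"
  let ?p = "ratfun_num f * ratfun_num g"
  have "f * g = to_fract ?p / to_fract ?q"
    by (subst ratfun_quotient[of f], subst ratfun_quotient[of g]) simp
  moreover have "poly ?q z \<noteq> 0"
    using assms by (simp add: regular_at_def)
  ultimately show "regular_at (f * g) z"
    "ratfun_eval (f * g) z = ratfun_eval f z * ratfun_eval g z"
    using assms regular_at_quotient[of "f * g" ?p ?q z]
    by (simp_all add: ratfun_eval_def)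
qed

text \<open>The polynomial \<open>pCons 0 q\<close> is \<lambda> times \<open>q\<close>.\<close>

lemma lam_diff_quotient:
  "lam - f = to_fract (pCons 0 (ratfun_den f) - ratfun_num f) / to_fract (ratfun_den f)"
proof -
  have "lam - f = lam - to_fract (ratfun_num f) / to_fract (ratfun_den f)"
    using ratfun_quotient[of f] by simp
  also have "\<dots> = to_fract ([:0, 1:] * ratfun_den f - ratfun_num f) / to_fract (ratfun_den f)"
    by (simp only: lam_def to_fract_mult to_fract_diff) (simp add: field_simps)
  finally show ?thesis by simp
qed

lemma
  assumes "regular_at f z"
  shows regular_at_lam_diff: "regular_at (lam - f) z"
    and ratfun_eval_lam_diff: "ratfun_eval (lam - f) z = z - ratfun_eval f z"
  using regular_at_quotient[OF lam_diff_quotient, of f z] assms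
  by (simp_all add: regular_at_def ratfun_eval_def diff_divide_distrib)

lemma regular_at_lam_diff_iff: "regular_at (lam - f) z \<longleftrightarrow> regular_at f z"
  using regular_at_lam_diff[of f z] regular_at_lam_diff[of "lam - f" z] by auto

text \<open>A common zero \<open>z\<close> would make \<lambda> - z a common factor of a coprime
  pair.\<close>

lemma ratfun_num_nonzero_at_pole:
  assumes "\<not> regular_at f z"
  shows "poly (ratfun_num f) z \<noteq> 0"
proof
  assume "poly (ratfun_num f) z = 0"
  then have "[:-z, 1:] dvd ratfun_num f" by (simp add: poly_eq_0_iff_dvd)
  moreover have "[:-z, 1:] dvd ratfun_den f"
    using assms by (simp add: regular_at_def poly_eq_0_iff_dvd)
  ultimately have "is_unit [:-z, 1:]"
    using coprime_quot_of_fract[of f] by (metis coprime_common_divisor)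
  then show False by (simp add: is_unit_pCons_iff)
qed

text \<open>Inversion swaps numerator and denominator. The numerator of \<open>f\<close> is nonzero
  at \<open>z\<close>: by assumption at a regular point, by coprimality at a pole. A pole of
  \<open>f\<close> thus becomes a zero of the inverse.\<close>

lemma
  assumes "regular_at f z \<Longrightarrow> ratfun_eval f z \<noteq> 0"
  shows regular_at_inverse: "regular_at (inverse f) z"
    and ratfun_eval_inverse:
      "ratfun_eval (inverse f) z = (if regular_at f z then inverse (ratfun_eval f z) else 0)"
proof -
  have inv: "inverse f = to_fract (ratfun_den f) / to_fract (ratfun_num f)"
    by (subst ratfun_quotient[of f]) simp
  have "poly (ratfun_num f) z \<noteq> 0"
    using assms ratfun_num_nonzero_at_pole[of f z] by (auto simp: ratfun_eval_def)
  note * = regular_at_quotient[OF inv this]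
  show "regular_at (inverse f) z" by (rule *(1))
  show "ratfun_eval (inverse f) z = (if regular_at f z then inverse (ratfun_eval f z) else 0)"
    using *(2) by (simp add: ratfun_eval_def regular_at_def)
qed

section \<open>Weights of numerator degree at most the denominator degree\<close>

definition proper_ratfun :: "ratfun \<Rightarrow> bool" where
  "proper_ratfun f \<longleftrightarrow> degree (ratfun_num f) \<le> degree (ratfun_den f)"

text \<open>Cancelling a common factor lowers both degrees by the same amount; the zero numerator is
  separate because degrees add only for nonzero factors.\<close>

lemma proper_ratfun_quotient:
  assumes "f = to_fract p / to_fract q" "q \<noteq> 0" "degree p \<le> degree q"
  shows "proper_ratfun f"
proof -
  from assms obtain d where d: "d \<noteq> 0" "p = ratfun_num f * d" "q = ratfun_den f * d"
    by (elim ratfun_cancel)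
  show ?thesis
  proof (cases "ratfun_num f = 0")
    case True
    then show ?thesis by (simp add: proper_ratfun_def)
  next
    case False
    have "degree p = degree (ratfun_num f) + degree d"
      using d(1) False unfolding d(2) by (rule degree_mult_eq[rotated])
    moreover have "degree q = degree (ratfun_den f) + degree d"
      using d(1) by (subst d(3), subst degree_mult_eq) auto
    ultimately show ?thesis using assms(3) by (simp add: proper_ratfun_def)
  qed
qed

lemma proper_ratfun_add:
  assumes "proper_ratfun f" "proper_ratfun g"
  shows "proper_ratfun (f + g)"
proof (rule proper_ratfun_quotient)
  let ?q = "ratfun_den f * ratfun_den g"
  let ?p = "ratfun_num f * ratfun_den g + ratfun_num g * ratfun_den f"
  show "f + g = to_fract ?p / to_fract ?q"
    by (subst ratfun_quotient[of f], subst ratfun_quotient[of g]) (simp add: add_frac_eq)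
  show "?q \<noteq> 0" by simp
  have q: "degree ?q = degree (ratfun_den f) + degree (ratfun_den g)"
    by (rule degree_mult_eq) auto
  show "degree ?p \<le> degree ?q"
    unfolding q using assms unfolding proper_ratfun_def
    by (intro degree_add_le order.trans[OF degree_mult_le]) auto
qed

lemma proper_ratfun_mult:
  assumes "proper_ratfun f" "proper_ratfun g"
  shows "proper_ratfun (f * g)"
proof (rule proper_ratfun_quotient)
  let ?q = "ratfun_den f * ratfun_den g"
  let ?p = "ratfun_num f * ratfun_num g"
  show "f * g = to_fract ?p / to_fract ?q"
    by (subst ratfun_quotient[of f], subst ratfun_quotient[of g]) simp
  show "?q \<noteq> 0" by simp
  have q: "degree ?q = degree (ratfun_den f) + degree (ratfun_den g)"
    by (rule degree_mult_eq) auto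
  show "degree ?p \<le> degree ?q"
    unfolding q using assms unfolding proper_ratfun_def
    by (intro order.trans[OF degree_mult_le]) auto
qed

text \<open>The term \<lambda> \<open>ratfun_den f\<close> dominates, so the numerator of
  \<open>lam - f\<close> has degree exactly one above its denominator. Hence it is nonzero, and the
  inverse is proper.\<close>

lemma
  assumes "proper_ratfun f"
  shows lam_diff_proper_nonzero: "lam - f \<noteq> 0"
    and proper_ratfun_inverse_lam_diff: "proper_ratfun (inverse (lam - f))"
proof -
  let ?q = "pCons 0 (ratfun_den f) - ratfun_num f"
  have deg: "degree ?q = Suc (degree (ratfun_den f))"
  proof -
    have "degree (- ratfun_num f) < degree (pCons 0 (ratfun_den f))"
      using assms by (simp add: proper_ratfun_def)
    from degree_add_eq_left[OF this] show ?thesis by simp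
  qed
  then have q0: "?q \<noteq> 0" by (metis degree_0 nat.distinct(1))
  have eq: "lam - f = to_fract ?q / to_fract (ratfun_den f)"
    by (rule lam_diff_quotient)
  then show "lam - f \<noteq> 0" using q0 by (simp del: to_fract_diff)
  have inv: "inverse (lam - f) = to_fract (ratfun_den f) / to_fract ?q"
    by (subst eq) (simp del: to_fract_diff)
  show "proper_ratfun (inverse (lam - f))"
    by (rule proper_ratfun_quotient[OF inv q0]) (simp add: deg)
qed


section \<open>Elimination of vertices\<close>

text \<open>The eigenvalue equations are posed over the field of rational functions, with \<lambda>
  as the indeterminate; no point is chosen yet.\<close>

definition solves_on :: "'v wdigraph \<Rightarrow> 'v set \<Rightarrow> ('v \<Rightarrow> ratfun) \<Rightarrow> bool" where
  "solves_on G A x \<longleftrightarrow> (\<forall>v\<in>A. lam * x v = (\<Sum>j\<in>verts G. weight G v j * x j))"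

text \<open>The existence of extensions in the last conjunct is what makes \<open>H\<close> unique.\<close>

definition is_elimination :: "'v wdigraph \<Rightarrow> 'v set \<Rightarrow> 'v wdigraph \<Rightarrow> bool" where
  "is_elimination G S H \<longleftrightarrow> H \<in> wdigraphs \<and> verts H = S \<and> S \<subseteq> verts G \<and>
     (\<forall>x. solves_on G (verts G - S) x \<longrightarrow>
       (\<forall>i\<in>S. (\<Sum>j\<in>verts G. weight G i j * x j) = (\<Sum>j\<in>S. weight H i j * x j))) \<and>
     (\<forall>y. \<exists>x. (\<forall>j\<in>S. x j = y j) \<and> solves_on G (verts G - S) x)"

lemma is_elimination_row:
  assumes "is_elimination G S H" "solves_on G (verts G - S) x" "i \<in> S"
  shows "(\<Sum>j\<in>verts G. weight G i j * x j) = (\<Sum>j\<in>S. weight H i j * x j)"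
  using assms by (simp add: is_elimination_def)

lemma is_elimination_extend:
  assumes "is_elimination G S H"
  shows "\<exists>x. (\<forall>j\<in>S. x j = y j) \<and> solves_on G (verts G - S) x"
  using assms by (simp add: is_elimination_def)

lemma is_elimination_refl:
  assumes "G \<in> wdigraphs"
  shows "is_elimination G (verts G) G"
  using assms by (auto simp: is_elimination_def solves_on_def)

lemma wdigraph_eqI:
  fixes H H' :: "'v wdigraph"
  assumes "H \<in> wdigraphs" "H' \<in> wdigraphs" "verts H = verts H'"
    and eq: "\<And>i j. i \<in> verts H \<Longrightarrow> j \<in> verts H \<Longrightarrow> weight H i j = weight H' i j"
  shows "H = H'"
proof -
  have "weight H i j = weight H' i j" for i j
  proof (cases "i \<in> verts H \<and> j \<in> verts H")
    case False
    then have "weight H i j = 0" "weight H' i j = 0"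
      using assms(1-3) by (auto simp: wdigraphs_def edges_def)
    then show ?thesis by simp
  qed (use eq in auto)
  then have "weight H = weight H'" by (intro ext)
  with assms(3) show ?thesis by (cases H; cases H') simp
qed

text \<open>On a solution that restricts to the unit vector at \<open>j\<close> on \<open>S\<close>,
  row \<open>i\<close> of either graph returns its entry at \<open>j\<close>, and both equal the
  same row of \<open>G\<close>.\<close>

lemma is_elimination_unique:
  assumes H: "is_elimination G S H" and H': "is_elimination G S H'"
  shows "H = H'"
proof (rule wdigraph_eqI)
  have verts: "verts H = S" "verts H' = S" and w: "H \<in> wdigraphs"
    using H H' by (auto simp: is_elimination_def)
  then have fin: "finite S" by (auto simp: wdigraphs_def)
  show "H \<in> wdigraphs" "H' \<in> wdigraphs" "verts H = verts H'"
    using H H' by (auto simp: is_elimination_def)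
  fix i j assume "i \<in> verts H" "j \<in> verts H"
  then have ij: "i \<in> S" "j \<in> S" by (simp_all add: verts)
  obtain x where x: "\<And>k. k \<in> S \<Longrightarrow> x k = (if k = j then 1 else 0)" "solves_on G (verts G - S) x"
    using is_elimination_extend[OF H, of "\<lambda>k. if k = j then 1 else 0"] by blast
  have "(\<Sum>k\<in>S. weight K i k * x k) = weight K i j" for K :: "'a wdigraph"
  proof -
    have "(\<Sum>k\<in>S. weight K i k * x k) = (\<Sum>k\<in>S. if k = j then weight K i k else 0)"
      by (intro sum.cong) (auto simp: x)
    then show ?thesis using fin ij by simp
  qed
  then show "weight H i j = weight H' i j"
    using is_elimination_row[OF H x(2) ij(1)] is_elimination_row[OF H' x(2) ij(1)] by metis
qed

text \<open>For a solution of the \<open>G\<close>-equations outside \<open>S\<close>, the rows of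
  \<open>G\<close> and \<open>H\<close> agree on \<open>S\<close>. So the remaining equations on
  \<open>S - T\<close> may be read in either graph.\<close>

lemma is_elimination_trans:
  assumes H: "is_elimination G S H" and K: "is_elimination H T K"
  shows "is_elimination G T K"
proof -
  have vH: "verts H = S" and SG: "S \<subseteq> verts G" and TS: "T \<subseteq> S"
    using H K by (auto simp: is_elimination_def)
  have row: "(\<Sum>j\<in>verts G. weight G i j * x j) = (\<Sum>j\<in>T. weight K i j * x j)"
    if x: "solves_on G (verts G - T) x" and i: "i \<in> T" for x i
  proof -
    have xS: "solves_on G (verts G - S) x" using x TS by (auto simp: solves_on_def)
    note rowS = is_elimination_row[OF H xS]
    have "solves_on H (verts H - T) x"
      using x SG rowS by (auto simp: solves_on_def vH)
    from is_elimination_row[OF K this i] rowS[of i] show ?thesis using i TS by (auto simp: vH)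
  qed
  have ext: "\<exists>x. (\<forall>j\<in>T. x j = y j) \<and> solves_on G (verts G - T) x" for y
  proof -
    \<comment> \<open>The boundary values are extended in two stages, first from \<open>T\<close> to
      \<open>S\<close> by a solution in \<open>H\<close>, then from \<open>S\<close> to all of
      \<open>G\<close>.\<close>
    obtain x' where x': "\<And>j. j \<in> T \<Longrightarrow> x' j = y j" "solves_on H (verts H - T) x'"
      using is_elimination_extend[OF K, of y] by blast
    obtain x where x: "\<And>j. j \<in> S \<Longrightarrow> x j = x' j" "solves_on G (verts G - S) x"
      using is_elimination_extend[OF H, of x'] by blast
    have "lam * x v = (\<Sum>j\<in>verts G. weight G v j * x j)" if v: "v \<in> verts G - T" for v
    proof (cases "v \<in> S")
      case True
      have "lam * x' v = (\<Sum>j\<in>S. weight H v j * x' j)"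
        using x'(2) True v by (simp add: solves_on_def vH)
      also have "\<dots> = (\<Sum>j\<in>S. weight H v j * x j)"
        by (intro sum.cong) (simp_all add: x)
      also have "\<dots> = (\<Sum>j\<in>verts G. weight G v j * x j)"
        using is_elimination_row[OF H x(2) True] by simp
      finally show ?thesis by (simp add: x True)
    next
      case False
      then show ?thesis using x(2) v by (simp add: solves_on_def)
    qed
    then have "solves_on G (verts G - T) x" by (simp add: solves_on_def)
    moreover have "\<forall>j\<in>T. x j = y j" using x(1) x'(1) TS by auto
    ultimately show ?thesis by blast
  qed
  show ?thesis
    using K SG TS row ext by (auto simp: is_elimination_def)
qed

text \<open>Gaussian elimination of one unknown: with the unit vector at \<open>j\<close> on the
  other vertices, the equation at \<open>v\<close> is solved for \<open>x v\<close> and the result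
  is substituted into row \<open>i\<close>.\<close>

lemma is_elimination_single:
  assumes G: "G \<in> wdigraphs" and H: "is_elimination G (verts G - {v}) H"
    and v: "v \<in> verts G" "weight G v v \<noteq> lam"
    and ij: "i \<in> verts G - {v}" "j \<in> verts G - {v}"
  shows "weight H i j =
    weight G i j + weight G i v * weight G v j * inverse (lam - weight G v v)"
proof -
  let ?S = "verts G - {v}"
  have fin: "finite (verts G)" using G by (simp add: wdigraphs_def)
  obtain x where x: "\<And>k. k \<in> ?S \<Longrightarrow> x k = (if k = j then 1 else 0)" "solves_on G (verts G - ?S) x"
    using is_elimination_extend[OF H, of "\<lambda>k. if k = j then 1 else 0"] by blast
  have S: "(\<Sum>k\<in>?S. weight K a k * x k) = weight K a j" for K :: "'a wdigraph" and a
  proof -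
    have "(\<Sum>k\<in>?S. weight K a k * x k) = (\<Sum>k\<in>?S. if k = j then weight K a k else 0)"
      by (intro sum.cong) (auto simp: x)
    then show ?thesis using fin ij by simp
  qed
  have V: "(\<Sum>k\<in>verts G. weight G a k * x k) = weight G a v * x v + weight G a j" for a
    using fin v(1) by (simp add: sum.remove[of _ v] S)
  have "lam * x v = weight G v v * x v + weight G v j"
    using x(2) v(1) by (simp add: solves_on_def V)
  then have "(lam - weight G v v) * x v = weight G v j" by (simp add: algebra_simps)
  then have "x v = weight G v j * inverse (lam - weight G v v)"
    using v(2) by (simp add: field_simps)
  moreover have "weight G i v * x v + weight G i j = weight H i j"
    using is_elimination_row[OF H x(2) ij(1)] by (simp add: S V)
  ultimately show ?thesis by (simp add: mult.assoc add.commute)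
qed


section \<open>Branch sums\<close>

lemma successively_conv_nth:
  "successively P xs \<longleftrightarrow> (\<forall>k < length xs - 1. P (xs ! k) (xs ! Suc k))"
proof (induction P xs rule: successively.induct)
  case (3 P x y xs)
  then show ?case by (auto simp: nth_Cons split: nat.splits)
qed auto

lemma is_nonloop_cycle_iff:
  "is_nonloop_cycle G us \<longleftrightarrow> 2 \<le> length us \<and> distinct us \<and>
     successively (\<lambda>a b. (a, b) \<in> edges G) us \<and> (last us, hd us) \<in> edges G"
  by (simp add: is_nonloop_cycle_def successively_conv_nth)

text \<open>A longest simple path in \<open>D\<close> exists by finiteness. Its last vertex has a
  different successor in \<open>D\<close>, which lies on the path by maximality, and the edge to it
  closes a cycle.\<close>

lemma nonloop_cycle_of_successors:
  assumes fin: "finite D" and "D \<noteq> {}"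
    and succ: "\<And>v. v \<in> D \<Longrightarrow> \<exists>u\<in>D. u \<noteq> v \<and> (v, u) \<in> edges G"
  obtains us where "is_nonloop_cycle G us" "set us \<subseteq> D"
proof -
  define P where "P us \<longleftrightarrow> us \<noteq> [] \<and> set us \<subseteq> D \<and> distinct us \<and>
    successively (\<lambda>a b. (a, b) \<in> edges G) us" for us
  obtain d where "d \<in> D" using \<open>D \<noteq> {}\<close> by blast
  then have "P [d]" by (simp add: P_def)
  moreover have "\<forall>us. P us \<longrightarrow> length us < Suc (card D)"
    using fin by (metis P_def card_mono distinct_card less_Suc_eq_le)
  ultimately have "\<exists>us. P us \<and> (\<forall>vs. P vs \<longrightarrow> length vs \<le> length us)"
    by (rule ex_has_greatest_nat)
  then obtain us where us: "P us" and max: "\<And>vs. P vs \<Longrightarrow> length vs \<le> length us"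
    by blast
  obtain s where s: "s \<in> D" "s \<noteq> last us" "(last us, s) \<in> edges G"
  proof -
    have "last us \<in> D" using us last_in_set[of us] by (auto simp: P_def)
    then show ?thesis using succ that by blast
  qed
  have "s \<in> set us"
  proof (rule ccontr)
    assume "s \<notin> set us"
    then have "P (us @ [s])"
      using us s by (auto simp: P_def successively_append_iff)
    from max[OF this] show False by simp
  qed
  then obtain ys zs where yz: "us = ys @ s # zs" by (meson split_list)
  \<comment> \<open>Since \<open>s\<close> is not the last vertex, the closed segment has at least
    two vertices and is no loop.\<close>
  have "zs \<noteq> []" using s(2) yz by auto
  then have "is_nonloop_cycle G (s # zs)"
    using us s by (cases zs) (auto simp: is_nonloop_cycle_iff P_def yz successively_append_iff)
  then show ?thesis using us yz by (intro that[of "s # zs"]) (auto simp: P_def)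
qed

text \<open>Branches without their first vertex. In the absence of non-loop cycles outside \<open>S\<close>, prepending
  a vertex outside \<open>S\<close> never destroys distinctness, which makes the path sums recursive.\<close>

definition interior_paths :: "'v wdigraph \<Rightarrow> 'v set \<Rightarrow> 'v \<Rightarrow> 'v \<Rightarrow> 'v list set" where
  "interior_paths G S u j = {us. us \<noteq> [] \<and> hd us = u \<and> last us = j \<and>
     successively (\<lambda>a b. (a, b) \<in> edges G) us \<and> distinct us \<and> set (butlast us) \<inter> S = {}}"

text \<open>What is left of a branch product after splitting off the weight of its first edge, in a
  form that recurses along the path.\<close>

fun path_factor :: "'v wdigraph \<Rightarrow> 'v list \<Rightarrow> ratfun" where
  "path_factor G (a # b # us) =
     weight G a b / (lam - weight G a a) * path_factor G (b # us)"
| "path_factor G us = 1"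

definition path_sum :: "'v wdigraph \<Rightarrow> 'v set \<Rightarrow> 'v \<Rightarrow> 'v \<Rightarrow> ratfun" where
  "path_sum G S u j = (\<Sum>us\<in>interior_paths G S u j. path_factor G us)"

lemma path_factor_conv_prod:
  "path_factor G us = (\<Prod>k<length us - 1.
     weight G (us ! k) (us ! Suc k) / (lam - weight G (us ! k) (us ! k)))"
proof (induction G us rule: path_factor.induct)
  case (1 G a b us)
  then show ?case by (simp add: prod.lessThan_Suc_shift del: prod.lessThan_Suc)
qed auto

lemma branch_product_Cons:
  assumes "us \<noteq> []"
  shows "branch_product G (i # us) = weight G i (hd us) * path_factor G us"
proof -
  have "{1..<length us} = Suc ` {..<length us - 1}"
    using assms by (simp add: lessThan_atLeast0 image_Suc_atLeastLessThan)
  then show ?thesis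
    using assms by (simp add: branch_product_def path_factor_conv_prod prod.reindex hd_conv_nth)
qed

lemma path_factor_Cons:
  assumes "us \<noteq> []"
  shows "path_factor G (i # us) = weight G i (hd us) / (lam - weight G i i) * path_factor G us"
  using assms by (cases us) auto

lemma finite_interior_paths:
  assumes "G \<in> wdigraphs" "u \<in> verts G"
  shows "finite (interior_paths G S u j)"
proof (rule finite_subset)
  have "set us \<subseteq> verts G"
    if "successively (\<lambda>a b. (a, b) \<in> edges G) us" "us \<noteq> []" "hd us \<in> verts G" for us
    using that
  proof (induction us)
    case (Cons a us)
    then have "(a, hd us) \<in> edges G" if "us \<noteq> []" using that by (simp add: successively_Cons)
    then have "hd us \<in> verts G" if "us \<noteq> []" using that assms(1) by (auto simp: wdigraphs_def)
    with Cons show ?case by (cases "us = []") (auto simp: successively_Cons)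
  qed simp
  then show "interior_paths G S u j \<subseteq> {us. set us \<subseteq> verts G \<and> distinct us}"
    using assms(2) unfolding interior_paths_def by blast
  show "finite {us. set us \<subseteq> verts G \<and> distinct us}"
    using assms(1) by (intro finite_subset_distinct) (simp add: wdigraphs_def)
qed

text \<open>Paths with different second vertices form disjoint families, so the sum splits by that
  vertex; non-neighbours drop out because \<open>c\<close> vanishes there. It serves both branch
  products and path factors, which differ only in the coefficient \<open>c\<close>.\<close>

lemma sum_Cons_interior_paths:
  fixes h :: "'v list \<Rightarrow> ratfun"
  assumes G: "G \<in> wdigraphs" and "U \<subseteq> verts G"
    and h: "\<And>us. us \<noteq> [] \<Longrightarrow> h (a # us) = c (hd us) * path_factor G us"
    and c: "\<And>u. (a, u) \<notin> edges G \<Longrightarrow> c u = 0"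
  shows "sum h ((#) a ` (\<Union>u\<in>{u\<in>U. (a, u) \<in> edges G}. interior_paths G S u j)) =
    (\<Sum>u\<in>U. c u * path_sum G S u j)"
proof -
  let ?U = "{u\<in>U. (a, u) \<in> edges G}"
  have fin: "finite U" using assms by (auto simp: wdigraphs_def intro: finite_subset)
  have "sum h ((#) a ` (\<Union>u\<in>?U. interior_paths G S u j)) =
      (\<Sum>us\<in>(\<Union>u\<in>?U. interior_paths G S u j). h (a # us))"
    by (simp add: sum.reindex)
  also have "\<dots> = (\<Sum>u\<in>?U. \<Sum>us\<in>interior_paths G S u j. h (a # us))"
  proof (rule sum.UNION_disjoint)
    show "\<forall>u\<in>?U. finite (interior_paths G S u j)"
      using finite_interior_paths[OF G] assms(2) by auto
  qed (use fin in \<open>auto simp: interior_paths_def\<close>)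
  also have "\<dots> = (\<Sum>u\<in>?U. c u * path_sum G S u j)"
    unfolding path_sum_def sum_distrib_left
    by (intro sum.cong refl) (auto simp: interior_paths_def h)
  also have "\<dots> = (\<Sum>u\<in>U. c u * path_sum G S u j)"
    using fin by (intro sum.mono_neutral_left) (auto simp: c)
  finally show ?thesis .
qed

text \<open>A path with an edge would have its first vertex in \<open>butlast\<close>, hence outside
  \<open>S\<close>; only the one-vertex path \<open>[u]\<close> can remain.\<close>

lemma path_sum_terminal:
  assumes "u \<in> S"
  shows "path_sum G S u j = (if u = j then 1 else 0)"
proof -
  have single: "us = [u]" if "us \<in> interior_paths G S u j" for us
    using that assms by (cases us) (auto simp: interior_paths_def split: if_splits)
  have "interior_paths G S u j = (if u = j then {[u]} else {})"
  proof (intro set_eqI iffI)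
    fix us assume us: "us \<in> interior_paths G S u j"
    have "us = [u]" by (rule single[OF us])
    moreover have "last us = j" using us by (simp add: interior_paths_def)
    ultimately show "us \<in> (if u = j then {[u]} else {})" by simp
  qed (simp add: interior_paths_def split: if_splits)
  then show ?thesis by (simp add: path_sum_def)
qed

text \<open>The interior avoids \<open>S\<close> while both ends lie in \<open>S\<close>, so the
  only possible repetition is the permitted one \<open>i = j\<close>. Dropping the first vertex
  therefore turns either distinctness condition into \<open>distinct us\<close>.\<close>

lemma Cons_mem_branches_iff:
  assumes S: "i \<in> S" "j \<in> S" and us: "us \<noteq> []"
  shows "i # us \<in> branches G S i j \<longleftrightarrow>
    (i, hd us) \<in> edges G \<and> us \<in> interior_paths G S (hd us) j"
proof -
  have len: "length (i # us) - 1 = length us" "2 \<le> length (i # us)" "hd (i # us) = i"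
    "last (i # us) = last us"
    using us by (auto simp: Suc_le_eq)
  have interior: "(\<forall>k \<in> {1..<length us}. (i # us) ! k \<notin> S) \<longleftrightarrow> set (butlast us) \<inter> S = {}"
  proof -
    have "{1..<length us} = Suc ` {..<length us - 1}"
      using us by (simp add: lessThan_atLeast0 image_Suc_atLeastLessThan)
    moreover have "set (butlast us) = (!) us ` {..<length us - 1}"
    proof -
      have "set (butlast us) = (!) (butlast us) ` {..<length us - 1}"
        using nth_image[of "length us - 1" "butlast us"] by (simp add: atLeast0LessThan)
      also have "\<dots> = (!) us ` {..<length us - 1}"
        by (intro image_cong) (auto simp: nth_butlast)
      finally show ?thesis .
    qed
    ultimately show ?thesis by auto
  qed
  have edge: "(\<forall>k < length us. ((i # us) ! k, (i # us) ! Suc k) \<in> edges G) \<longleftrightarrow>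
      (i, hd us) \<in> edges G \<and> successively (\<lambda>a b. (a, b) \<in> edges G) us"
    using us successively_conv_nth[of "\<lambda>a b. (a, b) \<in> edges G" "i # us"]
    unfolding len successively_Cons by blast
  have dist: "(if i = j then distinct (butlast (i # us)) else distinct (i # us)) \<longleftrightarrow> distinct us"
    if "last us = j" "set (butlast us) \<inter> S = {}"
  proof -
    define ys where "ys = butlast us"
    have ys: "us = ys @ [j]"
      using us that(1) append_butlast_last_id[of us] by (simp add: ys_def)
    have "set ys \<inter> S = {}" using that(2) by (simp add: ys)
    then show ?thesis using S by (auto simp: ys butlast_append)
  qed
  have "i # us \<in> branches G S i j \<longleftrightarrow> last us = j \<and>
      ((i, hd us) \<in> edges G \<and> successively (\<lambda>a b. (a, b) \<in> edges G) us) \<and>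
      (if i = j then distinct (butlast (i # us)) else distinct (i # us)) \<and>
      set (butlast us) \<inter> S = {}"
    by (simp only: branches_def mem_Collect_eq len interior edge simp_thms)
  also have "\<dots> \<longleftrightarrow> last us = j \<and>
      ((i, hd us) \<in> edges G \<and> successively (\<lambda>a b. (a, b) \<in> edges G) us) \<and>
      distinct us \<and> set (butlast us) \<inter> S = {}"
  proof (cases "last us = j \<and> set (butlast us) \<inter> S = {}")
    case True
    then show ?thesis by (simp only: dist[OF conjunct1 conjunct2, OF True True])
  qed blast
  finally show ?thesis using us by (auto simp: interior_paths_def)
qed

lemma branches_conv_interior_paths:
  assumes G: "G \<in> wdigraphs" and S: "i \<in> S" "j \<in> S"
  shows "branches G S i j =
    (#) i ` (\<Union>u\<in>{u\<in>verts G. (i, u) \<in> edges G}. interior_paths G S u j)"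
proof (intro set_eqI iffI)
  fix us assume us: "us \<in> branches G S i j"
  then obtain vs where vs: "us = i # vs" "vs \<noteq> []"
    by (cases us; cases "tl us") (auto simp: branches_def)
  then have "(i, hd vs) \<in> edges G" "vs \<in> interior_paths G S (hd vs) j"
    using us Cons_mem_branches_iff[OF S] by blast+
  then show "us \<in> (#) i ` (\<Union>u\<in>{u\<in>verts G. (i, u) \<in> edges G}. interior_paths G S u j)"
    using vs G by (auto simp: wdigraphs_def)
next
  fix us assume "us \<in> (#) i ` (\<Union>u\<in>{u\<in>verts G. (i, u) \<in> edges G}. interior_paths G S u j)"
  then obtain vs u where vs: "us = i # vs" "(i, u) \<in> edges G" "vs \<in> interior_paths G S u j"
    by blast
  then have "vs \<noteq> []" "hd vs = u" by (auto simp: interior_paths_def)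
  then show "us \<in> branches G S i j"
    using vs Cons_mem_branches_iff[OF S] by blast
qed

lemma interior_paths_Cons:
  assumes G: "G \<in> wdigraphs" and S: "structural_set G S"
    and v: "v \<in> verts G - S" and j: "j \<in> S"
  shows "interior_paths G S v j =
    (#) v ` (\<Union>u\<in>{u\<in>verts G - {v}. (v, u) \<in> edges G}. interior_paths G S u j)"
proof (intro set_eqI iffI)
  fix us assume us: "us \<in> interior_paths G S v j"
  then obtain vs where vs: "us = v # vs" "vs \<noteq> []"
    using v j by (cases us) (auto simp: interior_paths_def split: if_splits)
  have "vs \<in> interior_paths G S (hd vs) j" "(v, hd vs) \<in> edges G" "hd vs \<noteq> v"
    using us vs hd_in_set[OF vs(2)] by (auto simp: interior_paths_def successively_Cons)
  then show "us \<in> (#) v ` (\<Union>u\<in>{u\<in>verts G - {v}. (v, u) \<in> edges G}. interior_paths G S u j)"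
    using vs G by (auto simp: wdigraphs_def)
next
  fix us assume "us \<in> (#) v ` (\<Union>u\<in>{u\<in>verts G - {v}. (v, u) \<in> edges G}. interior_paths G S u j)"
  then obtain vs u where vs: "us = v # vs" "(v, u) \<in> edges G" "u \<noteq> v" "vs \<in> interior_paths G S u j"
    by blast
  have "v \<notin> set vs"
  proof
    assume "v \<in> set vs"
    then obtain ys zs where yz: "vs = ys @ v # zs" by (meson split_list)
    \<comment> \<open>The path starts at \<open>u \<noteq> v\<close>, so its segment up to
      \<open>v\<close> has at least two vertices. The edge from \<open>v\<close> to \<open>u\<close>
      closes it to a cycle outside \<open>S\<close>.\<close>
    then have "ys \<noteq> []" using vs by (auto simp: interior_paths_def)
    then have "is_nonloop_cycle G (ys @ [v])"
      using vs by (auto simp: is_nonloop_cycle_iff interior_paths_def yz successively_append_iff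
          Suc_le_eq)
    moreover have "set (ys @ [v]) \<inter> S = {}"
      using vs(4) v by (auto simp: interior_paths_def yz butlast_append)
    ultimately show False using S unfolding structural_set_def by blast
  qed
  then show "us \<in> interior_paths G S v j"
    using vs v by (auto simp: interior_paths_def successively_Cons)
qed

text \<open>Splitting paths by their second vertex and clearing the denominator
  \<open>lam - weight G v v\<close> restores the loop term. With \<open>path_sum_terminal\<close>,
  the path sums into \<open>j\<close> solve the equations outside \<open>S\<close> with the unit
  vector at \<open>j\<close> as boundary values.\<close>

lemma path_sum_harmonic:
  assumes G: "G \<in> wdigraphs" and S: "structural_set G S"
    and v: "v \<in> verts G - S" and j: "j \<in> S"
  shows "lam * path_sum G S v j = (\<Sum>u\<in>verts G. weight G v u * path_sum G S u j)"
proof -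
  let ?d = "lam - weight G v v"
  have "weight G v v \<noteq> lam" using S v by (simp add: structural_set_def)
  then have d: "?d \<noteq> 0" by simp
  have "path_sum G S v j = (\<Sum>u\<in>verts G - {v}. weight G v u / ?d * path_sum G S u j)"
    unfolding path_sum_def[of G S v j] interior_paths_Cons[OF assms]
    by (rule sum_Cons_interior_paths[OF G]) (auto simp: path_factor_Cons edges_def)
  then have "?d * path_sum G S v j = (\<Sum>u\<in>verts G - {v}. weight G v u * path_sum G S u j)"
    using d by (simp add: sum_distrib_left)
  moreover have "finite (verts G)" using G by (simp add: wdigraphs_def)
  ultimately show ?thesis using v by (simp add: sum.remove[of _ v] algebra_simps)
qed

lemma isospectral_reduction_weight:
  assumes G: "G \<in> wdigraphs" and S: "i \<in> S" "j \<in> S"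
  shows "weight (isospectral_reduction G S) i j =
    (\<Sum>u\<in>verts G. weight G i u * path_sum G S u j)"
proof -
  have "weight (isospectral_reduction G S) i j = (\<Sum>us\<in>branches G S i j. branch_product G us)"
    using S by (simp add: isospectral_reduction_def)
  also have "\<dots> = (\<Sum>u\<in>verts G. weight G i u * path_sum G S u j)"
    unfolding branches_conv_interior_paths[OF assms]
    by (rule sum_Cons_interior_paths[OF G]) (auto simp: branch_product_Cons edges_def)
  finally show ?thesis .
qed

section \<open>Isospectral reduction as elimination\<close>

lemma solves_on_diff:
  assumes "solves_on G A x" "solves_on G A y"
  shows "solves_on G A (\<lambda>v. x v - y v)"
  using assms by (simp add: solves_on_def right_diff_distrib sum_subtractf)

text \<open>On the support of \<open>x\<close>, the equation at a vertex needs a second nonzero term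
  because its loop weight is not \<lambda>. So every support vertex has another one as successor,
  which yields a non-loop cycle avoiding \<open>S\<close>.\<close>

lemma solves_on_unique_zero:
  assumes G: "G \<in> wdigraphs" and S: "structural_set G S"
    and x: "solves_on G (verts G - S) x" "\<And>j. j \<in> S \<Longrightarrow> x j = 0"
    and v: "v \<in> verts G"
  shows "x v = 0"
proof (rule ccontr)
  define D where "D = {u \<in> verts G. x u \<noteq> 0}"
  assume "x v \<noteq> 0"
  then have "D \<noteq> {}" using v by (auto simp: D_def)
  have finV: "finite (verts G)" using G by (simp add: wdigraphs_def)
  then have fin: "finite D" by (simp add: D_def)
  have DS: "D \<inter> S = {}" using x(2) by (auto simp: D_def)
  have succ: "\<exists>u\<in>D. u \<noteq> w \<and> (w, u) \<in> edges G" if w: "w \<in> D" for w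
  proof (rule ccontr)
    assume "\<not> ?thesis"
    then have "(\<Sum>u\<in>verts G - {w}. weight G w u * x u) = 0"
      by (intro sum.neutral) (auto simp: D_def edges_def)
    moreover have "w \<in> verts G - S" using w DS by (auto simp: D_def)
    ultimately have "lam * x w = weight G w w * x w"
      using x(1) finV by (simp add: solves_on_def sum.remove[of _ w])
    then have "weight G w w = lam" using w by (simp add: D_def)
    then show False using S \<open>w \<in> verts G - S\<close> by (simp add: structural_set_def)
  qed
  obtain us where "is_nonloop_cycle G us" "set us \<subseteq> D"
    using nonloop_cycle_of_successors[OF fin \<open>D \<noteq> {}\<close> succ] by blast
  then show False using S DS unfolding structural_set_def by blast
qed

text \<open>By linearity, path sums weighted by boundary values give a solution
  \<open>ext y\<close>, and by uniqueness every solution has this form. Inserting it into a row of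
  \<open>G\<close> produces the branch sums.\<close>

lemma is_elimination_isospectral_reduction:
  assumes G: "G \<in> wdigraphs" and S: "structural_set G S"
  shows "is_elimination G S (isospectral_reduction G S)"
proof -
  let ?H = "isospectral_reduction G S"
  have SG: "S \<subseteq> verts G" "S \<noteq> {}" using S by (auto simp: structural_set_def)
  have finV: "finite (verts G)" using G by (simp add: wdigraphs_def)
  then have finS: "finite S" using SG finite_subset by blast
  have H: "?H \<in> wdigraphs" "verts ?H = S"
    using finS SG by (auto simp: wdigraphs_def isospectral_reduction_def edges_def)
  define ext where "ext y u = (\<Sum>j\<in>S. path_sum G S u j * y j)" for y u
  have ext_S: "ext y u = y u" if "u \<in> S" for y u
  proof -
    have "ext y u = (\<Sum>j\<in>S. if u = j then y j else 0)"
      unfolding ext_def by (intro sum.cong) (auto simp: path_sum_terminal that)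
    then show ?thesis using finS that by simp
  qed
  have sum_ext: "(\<Sum>u\<in>verts G. weight G i u * ext y u) =
      (\<Sum>j\<in>S. (\<Sum>u\<in>verts G. weight G i u * path_sum G S u j) * y j)" for i y
    unfolding ext_def sum_distrib_left sum_distrib_right
    by (subst sum.swap) (simp add: mult.assoc)
  have ext_solves: "solves_on G (verts G - S) (ext y)" for y
    unfolding solves_on_def sum_ext
    by (auto simp: ext_def sum_distrib_left path_sum_harmonic[OF G S, symmetric] mult.assoc)
  have row: "(\<Sum>j\<in>verts G. weight G i j * x j) = (\<Sum>j\<in>S. weight ?H i j * x j)"
    if x: "solves_on G (verts G - S) x" and i: "i \<in> S" for x i
  proof -
    have "x v = ext x v" if "v \<in> verts G" for v
      using solves_on_unique_zero[OF G S solves_on_diff[OF x ext_solves[of x]] _ that]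
      by (simp add: ext_S)
    then have "(\<Sum>j\<in>verts G. weight G i j * x j) = (\<Sum>j\<in>verts G. weight G i j * ext x j)"
      by (intro sum.cong) auto
    also have "\<dots> = (\<Sum>j\<in>S. weight ?H i j * x j)"
      unfolding sum_ext by (intro sum.cong refl) (simp add: isospectral_reduction_weight G i)
    finally show ?thesis .
  qed
  have "\<exists>x. (\<forall>j\<in>S. x j = y j) \<and> solves_on G (verts G - S) x" for y
    using ext_S ext_solves by blast
  with H SG(1) row show ?thesis by (auto simp: is_elimination_def)
qed

section \<open>Independence of the order of reductions\<close>

lemma is_elimination_final_reduction:
  assumes "G \<in> wdigraphs" "Ss \<noteq> []" "reduction_sequence G Ss"
  shows "is_elimination G (last Ss) (final_reduction G Ss)"
  using assms
proof (induction Ss arbitrary: G)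
  case (Cons S Ss)
  let ?H = "isospectral_reduction G S"
  have H: "is_elimination G S ?H"
    using Cons.prems by (intro is_elimination_isospectral_reduction) auto
  show ?case
  proof (cases "Ss = []")
    case True
    then show ?thesis using H by (simp add: final_reduction_def)
  next
    case False
    have "?H \<in> wdigraphs" using H by (simp add: is_elimination_def)
    then have "is_elimination ?H (last Ss) (final_reduction ?H Ss)"
      using Cons False by simp
    then show ?thesis
      using is_elimination_trans[OF H] False by (simp add: final_reduction_def)
  qed
qed simp

text \<open>Every sequence ending in \<open>V\<close> produces an elimination of \<open>G\<close>
  onto \<open>V\<close>, and there is only one, so the definite description is met by any such
  sequence.\<close>

lemma reduction_onto_eqI:
  assumes "G \<in> wdigraphs" "Ss \<noteq> []" "last Ss = V" "reduction_sequence G Ss"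
  shows "reduction_onto G V = final_reduction G Ss"
  unfolding reduction_onto_def
proof (rule the_equality)
  show "\<exists>Ts. Ts \<noteq> [] \<and> last Ts = V \<and> reduction_sequence G Ts \<and>
      final_reduction G Ss = final_reduction G Ts"
    using assms by blast
next
  fix H assume "\<exists>Ts. Ts \<noteq> [] \<and> last Ts = V \<and> reduction_sequence G Ts \<and> H = final_reduction G Ts"
  then obtain Ts where "Ts \<noteq> []" "last Ts = V" "reduction_sequence G Ts" "H = final_reduction G Ts"
    by blast
  then have "is_elimination G V H"
    using is_elimination_final_reduction[OF assms(1)] by blast
  then show "H = final_reduction G Ss"
    using is_elimination_final_reduction[OF assms(1,2,4)] assms(3) is_elimination_unique by blast
qed


section \<open>Gershgorin regions\<close>

text \<open>The condition that row \<open>i\<close> does not put \<open>z\<close> into the region,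
  expressed in the original weights. At a pole of the loop weight the implication is
  vacuous.\<close>

definition gersh_dominant :: "'v wdigraph \<Rightarrow> 'v \<Rightarrow> complex \<Rightarrow> bool" where
  "gersh_dominant G i z \<longleftrightarrow>
     (\<forall>j\<in>verts G - {i}. regular_at (weight G i j) z) \<and>
     (regular_at (weight G i i) z \<longrightarrow>
        (\<Sum>j\<in>verts G - {i}. cmod (ratfun_eval (weight G i j) z)) <
          cmod (z - ratfun_eval (weight G i i) z))"

lemma row_den_mult_weight:
  assumes "finite (verts G)" "j \<in> verts G"
  shows "to_fract (row_den G i) * weight G i j =
    to_fract ((\<Prod>k\<in>verts G - {j}. ratfun_den (weight G i k)) * ratfun_num (weight G i j))"
proof -
  let ?q = "ratfun_den (weight G i j)" and ?r = "\<Prod>k\<in>verts G - {j}. ratfun_den (weight G i k)"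
  have "row_den G i = ?r * ?q"
    using assms by (simp add: row_den_def prod.remove[of _ j] mult.commute)
  moreover have "to_fract ?q * weight G i j = to_fract (ratfun_num (weight G i j))"
    by (subst (2) ratfun_quotient[of "weight G i j"]) simp
  ultimately show ?thesis by (simp add: mult.assoc)
qed

text \<open>Up to \<lambda> on the diagonal, the extension has values \<open>r j * n j\<close>,
  where \<open>r j\<close> omits one factor of the row denominator \<open>L\<close>. An off-diagonal
  pole makes \<open>L\<close> and \<open>r i\<close> vanish, so the left side is 0. A pole on the
  diagonal alone leaves \<open>r i * n i \<noteq> 0\<close> against radius 0. Without poles both
  sides are scaled by \<open>cmod L > 0\<close>.\<close>

lemma not_gersh_dominant_iff:
  assumes G: "G \<in> wdigraphs" and i: "i \<in> verts G"
  shows "\<not> gersh_dominant G i z \<longleftrightarrow>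
    cmod (z - ratfun_eval (weight (polynomial_extension G) i i) z)
      \<le> gersh_radius (polynomial_extension G) i z"
proof -
  have fin: "finite (verts G)" using G by (simp add: wdigraphs_def)
  define r where "r j = (\<Prod>k\<in>verts G - {j}. poly (ratfun_den (weight G i k)) z)" for j
  define n where "n j = poly (ratfun_num (weight G i j)) z" for j
  define L where "L = poly (row_den G i) z"
  have L: "L = poly (ratfun_den (weight G i j)) z * r j" if "j \<in> verts G" for j
    using fin that by (simp add: L_def r_def row_den_def poly_prod prod.remove[of _ j])
  have off: "ratfun_eval (weight (polynomial_extension G) i j) z = r j * n j"
    if "j \<in> verts G - {i}" for j
  proof -
    have "weight (polynomial_extension G) i j = to_fract (row_den G i) * weight G i j"
      using that i by (auto simp: polynomial_extension_def)
    then show ?thesis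
      using that fin by (simp only: row_den_mult_weight ratfun_eval_to_fract DiffD1)
        (simp add: r_def n_def poly_prod)
  qed
  have diag: "z - ratfun_eval (weight (polynomial_extension G) i i) z = L * z - r i * n i"
  proof -
    have "weight (polynomial_extension G) i i =
        to_fract (row_den G i) * weight G i i - to_fract (row_den G i) * lam + lam"
      using i by (simp add: polynomial_extension_def algebra_simps)
    also have "\<dots> = to_fract ((\<Prod>k\<in>verts G - {i}. ratfun_den (weight G i k)) *
        ratfun_num (weight G i i) - row_den G i * [:0, 1:] + [:0, 1:])"
      by (simp only: row_den_mult_weight[OF fin i] lam_def to_fract_add to_fract_diff to_fract_mult)
    finally show ?thesis
      by (simp only: ratfun_eval_to_fract) (simp add: r_def n_def L_def poly_prod)
  qed
  have rad: "gersh_radius (polynomial_extension G) i z = (\<Sum>j\<in>verts G - {i}. cmod (r j * n j))"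
  proof -
    have "verts (polynomial_extension G) = verts G" by (simp add: polynomial_extension_def)
    then show ?thesis by (simp add: gersh_radius_def off)
  qed
  have pole: "r k = 0" if "j \<in> verts G" "\<not> regular_at (weight G i j) z" "k \<noteq> j" for j k
    using that fin by (auto simp: r_def regular_at_def prod_zero_iff)
  consider (off_pole) j where "j \<in> verts G - {i}" "\<not> regular_at (weight G i j) z"
    | (diag_pole) "\<forall>j\<in>verts G - {i}. regular_at (weight G i j) z" "\<not> regular_at (weight G i i) z"
    | (regular) "\<forall>j\<in>verts G. regular_at (weight G i j) z"
    by blast
  then show ?thesis
  proof cases
    case off_pole
    then have "L = 0" "r i = 0" using L[of j] pole[of j i] by (auto simp: regular_at_def)
    then have "cmod (L * z - r i * n i) \<le> (\<Sum>j\<in>verts G - {i}. cmod (r j * n j))"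
      by (simp add: sum_nonneg)
    moreover have "\<not> gersh_dominant G i z"
      using off_pole by (auto simp: gersh_dominant_def)
    ultimately show ?thesis by (simp add: diag rad)
  next
    case diag_pole
    have "L = 0" using L[OF i] diag_pole by (simp add: regular_at_def)
    moreover have "r i \<noteq> 0" using diag_pole fin by (auto simp: r_def regular_at_def prod_zero_iff)
    moreover have "n i \<noteq> 0" using diag_pole ratfun_num_nonzero_at_pole by (simp add: n_def)
    moreover have "(\<Sum>j\<in>verts G - {i}. cmod (r j * n j)) = 0"
      using pole[OF i] diag_pole by (intro sum.neutral) auto
    moreover have "gersh_dominant G i z"
      using diag_pole by (auto simp: gersh_dominant_def)
    ultimately show ?thesis by (simp add: diag rad)
  next
    case regular
    have L0: "L \<noteq> 0"
      using regular fin by (simp add: L_def row_den_def poly_prod prod_zero_iff regular_at_def)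
    have rn: "r j * n j = L * ratfun_eval (weight G i j) z" if "j \<in> verts G" for j
      using L[OF that] regular that by (simp add: n_def ratfun_eval_def regular_at_def)
    have "(\<Sum>j\<in>verts G - {i}. cmod (r j * n j)) =
        cmod L * (\<Sum>j\<in>verts G - {i}. cmod (ratfun_eval (weight G i j) z))"
      by (simp add: rn sum_distrib_left norm_mult)
    moreover have "cmod (L * z - r i * n i) = cmod L * cmod (z - ratfun_eval (weight G i i) z)"
      by (simp add: rn i right_diff_distrib flip: norm_mult)
    ultimately show ?thesis
      using L0 regular i by (auto simp: diag rad gersh_dominant_def)
  qed
qed

lemma mem_BW_Gamma_iff:
  assumes "G \<in> wdigraphs"
  shows "z \<in> BW_Gamma G \<longleftrightarrow> (\<exists>i\<in>verts G. \<not> gersh_dominant G i z)"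
  using not_gersh_dominant_iff[OF assms] by (auto simp: BW_Gamma_def)

text \<open>Entry \<open>j\<close> of row \<open>i\<close> changes by
  \<open>?e i v * ?e v j * c\<close>, and dominance of row \<open>v\<close> bounds
  \<open>cmod c\<close> times its off-diagonal sum by 1. Hence all changes together, the diagonal
  one included, cost at most \<open>cmod (?e i v)\<close>, the summand that row \<open>i\<close>
  loses with \<open>v\<close>.\<close>

lemma gersh_dominant_elimination:
  assumes G: "G \<in> wdigraphs" and H: "is_elimination G (verts G - {v}) H"
    and v: "v \<in> verts G" "weight G v v \<noteq> lam" and i: "i \<in> verts G - {v}"
    and dom: "gersh_dominant G v z" "gersh_dominant G i z"
  shows "gersh_dominant H i z"
proof -
  let ?e = "\<lambda>a b. ratfun_eval (weight G a b) z"
  define f where "f = inverse (lam - weight G v v)"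
  define c where "c = ratfun_eval f z"
  have fin: "finite (verts G)" using G by (simp add: wdigraphs_def)
  have vH: "verts H = verts G - {v}" using H by (simp add: is_elimination_def)
  have w: "weight H i j = weight G i j + weight G i v * weight G v j * f"
    if "j \<in> verts G - {v}" for j
    using is_elimination_single[OF G H v i that] by (simp add: f_def)
  have reg_v: "regular_at (weight G v j) z" if "j \<in> verts G - {v}" for j
    using dom(1) that by (simp add: gersh_dominant_def)
  have reg_i: "regular_at (weight G i j) z" if "j \<in> verts G - {i}" for j
    using dom(2) that by (simp add: gersh_dominant_def)
  have strict: "(\<Sum>j\<in>verts G - {v}. cmod (?e v j)) < cmod (z - ?e v v)"
    if "regular_at (weight G v v) z"
    using dom(1) that by (simp add: gersh_dominant_def)
  have nz: "ratfun_eval (lam - weight G v v) z \<noteq> 0" if "regular_at (lam - weight G v v) z"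
  proof -
    have r: "regular_at (weight G v v) z" using that by (simp add: regular_at_lam_diff_iff)
    have "0 \<le> (\<Sum>j\<in>verts G - {v}. cmod (?e v j))" by (simp add: sum_nonneg)
    with strict[OF r] r show ?thesis by (auto simp: ratfun_eval_lam_diff)
  qed
  have reg_f: "regular_at f z"
    unfolding f_def using nz by (rule regular_at_inverse)
  \<comment> \<open>At a pole of the loop weight of \<open>v\<close> the correction vanishes, so the
    bound \<open>small\<close> holds trivially there.\<close>
  have c: "c = (if regular_at (weight G v v) z then inverse (z - ?e v v) else 0)"
    unfolding c_def f_def
    by (subst ratfun_eval_inverse[OF nz])
      (auto simp: regular_at_lam_diff_iff ratfun_eval_lam_diff)
  have small: "(\<Sum>j\<in>verts G - {v}. cmod (?e v j)) * cmod c \<le> 1"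
  proof (cases "regular_at (weight G v v) z")
    case True
    from strict[OF this] have "0 < cmod (z - ?e v v)"
      by (rule le_less_trans[OF sum_nonneg, rotated]) simp
    with strict[OF True] show ?thesis
      using True by (simp add: c norm_inverse norm_divide field_simps)
  qed (simp add: c)
  have reg_t: "regular_at (weight G i v * weight G v j * f) z"
    and eval_t: "ratfun_eval (weight G i v * weight G v j * f) z = ?e i v * ?e v j * c"
    if "j \<in> verts G - {v}" for j
  proof -
    have "regular_at (weight G i v) z" using i v(1) by (intro reg_i) auto
    then show "regular_at (weight G i v * weight G v j * f) z"
      "ratfun_eval (weight G i v * weight G v j * f) z = ?e i v * ?e v j * c"
      using reg_v[OF that] reg_f by (simp_all add: regular_at_mult ratfun_eval_mult c_def)
  qed
  have reg_H: "regular_at (weight H i j) z" "ratfun_eval (weight H i j) z = ?e i j + ?e i v * ?e v j * c"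
    if "j \<in> verts G - {v}" "regular_at (weight G i j) z" for j
    using that by (simp_all add: w reg_t eval_t regular_at_add ratfun_eval_add)
  show ?thesis
    unfolding gersh_dominant_def vH
  proof (intro conjI ballI impI)
    fix j assume "j \<in> verts G - {v} - {i}"
    then show "regular_at (weight H i j) z" using reg_i by (intro reg_H) auto
  next
    assume "regular_at (weight H i i) z"
    \<comment> \<open>The correction term is regular at \<open>z\<close>, so it cannot cancel a pole
      of the loop weight of \<open>i\<close>.\<close>
    then have r: "regular_at (weight G i i) z"
      using i by (simp add: w regular_at_add_iff[OF reg_t])
    let ?U = "verts G - {v} - {i}"
    have iv: "i \<noteq> v" using i by simp
    have split_v: "(\<Sum>j\<in>verts G - {v}. cmod (?e v j)) = cmod (?e v i) + (\<Sum>j\<in>?U. cmod (?e v j))"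
      using fin i by (simp add: sum.remove[of _ i])
    have split_i: "(\<Sum>j\<in>verts G - {i}. cmod (?e i j)) = cmod (?e i v) + (\<Sum>j\<in>?U. cmod (?e i j))"
    proof -
      have "verts G - {i} - {v} = ?U" by blast
      then show ?thesis using fin v iv by (simp add: sum.remove[of _ v])
    qed
    have "(\<Sum>j\<in>?U. cmod (ratfun_eval (weight H i j) z)) =
        (\<Sum>j\<in>?U. cmod (?e i j + ?e i v * ?e v j * c))"
      using reg_i by (intro sum.cong) (auto simp: reg_H)
    also have "\<dots> \<le> (\<Sum>j\<in>?U. cmod (?e i j) + cmod (?e i v) * cmod c * cmod (?e v j))"
      by (intro sum_mono order.trans[OF norm_triangle_ineq]) (simp add: norm_mult)
    also have "\<dots> = (\<Sum>j\<in>?U. cmod (?e i j)) + cmod (?e i v) * (cmod c * (\<Sum>j\<in>?U. cmod (?e v j)))"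
      by (simp add: sum.distrib sum_distrib_left mult.assoc)
    \<comment> \<open>The bound \<open>small\<close> is used with its summand at \<open>i\<close>
      moved to the right.\<close>
    also have "\<dots> \<le> (\<Sum>j\<in>?U. cmod (?e i j)) + cmod (?e i v) * (1 - cmod (?e v i) * cmod c)"
      using small by (intro add_left_mono mult_left_mono) (simp_all add: split_v algebra_simps)
    \<comment> \<open>The lost summand completes the old radius of row \<open>i\<close>; what is
      subtracted is exactly the size of the diagonal correction.\<close>
    also have "\<dots> = (\<Sum>j\<in>verts G - {i}. cmod (?e i j)) - cmod (?e i v * ?e v i * c)"
      by (simp add: split_i norm_mult algebra_simps)
    also have "\<dots> < cmod (z - ?e i i) - cmod (?e i v * ?e v i * c)"
      using dom(2) r by (simp add: gersh_dominant_def)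
    also have "\<dots> \<le> cmod (z - ?e i i - ?e i v * ?e v i * c)"
      by (rule norm_triangle_ineq2)
    also have "\<dots> = cmod (z - ratfun_eval (weight H i i) z)"
      using i r by (simp add: reg_H diff_diff_eq)
    finally show "(\<Sum>j\<in>?U. cmod (ratfun_eval (weight H i j) z)) < cmod (z - ratfun_eval (weight H i i) z)" .
  qed
qed

text \<open>By contraposition: if every row of \<open>G\<close> is dominant at \<open>z\<close>,
  then row \<open>v\<close> and row \<open>i\<close> are, hence so is each row \<open>i\<close> of
  \<open>H\<close>.\<close>

lemma BW_Gamma_elimination_subset:
  assumes G: "G \<in> wdigraphs" and H: "is_elimination G (verts G - {v}) H"
    and v: "v \<in> verts G" "weight G v v \<noteq> lam"
  shows "BW_Gamma H \<subseteq> BW_Gamma G"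
proof
  have vH: "verts H = verts G - {v}" "H \<in> wdigraphs" using H by (auto simp: is_elimination_def)
  fix z assume "z \<in> BW_Gamma H"
  then obtain i where "i \<in> verts G - {v}" "\<not> gersh_dominant H i z"
    using mem_BW_Gamma_iff[OF vH(2)] vH(1) by auto
  then show "z \<in> BW_Gamma G"
    using gersh_dominant_elimination[OF G H v] v(1) mem_BW_Gamma_iff[OF G] by blast
qed

section \<open>Removing the vertices one at a time\<close>

lemma wdigraphs_pi_iff:
  "G \<in> wdigraphs_pi \<longleftrightarrow>
    G \<in> wdigraphs \<and> (\<forall>u\<in>verts G. \<forall>v\<in>verts G. proper_ratfun (weight G u v))"
  by (simp add: wdigraphs_pi_def proper_ratfun_def)

text \<open>Induction on the number of vertices outside \<open>V\<close>. Properness of the weights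
  excludes the loop weight \<lambda>, so any single vertex can be removed, and the elimination
  formula keeps the weights proper.\<close>

lemma reduction_sequence_exists_BW_Gamma_subset:
  assumes "G \<in> wdigraphs_pi" "V \<noteq> {}" "V \<subseteq> verts G"
  shows "\<exists>Ss. Ss \<noteq> [] \<and> last Ss = V \<and> reduction_sequence G Ss \<and>
    BW_Gamma (final_reduction G Ss) \<subseteq> BW_Gamma G"
  using assms
proof (induction "card (verts G - V)" arbitrary: G)
  case 0
  then have G: "G \<in> wdigraphs" "finite (verts G)" by (auto simp: wdigraphs_pi_iff wdigraphs_def)
  with 0 have V: "verts G = V" by auto
  have "set us \<inter> V \<noteq> {}" if "is_nonloop_cycle G us" for us
  proof -
    have "us \<noteq> []" "last us \<in> V"
      using that G(1) V by (auto simp: is_nonloop_cycle_def wdigraphs_def)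
    then show ?thesis by force
  qed
  then have S: "structural_set G V" using V 0 by (auto simp: structural_set_def)
  \<comment> \<open>The sequence has to be nonempty, so the base case reduces over all vertices; by
    uniqueness of elimination this changes nothing.\<close>
  have "isospectral_reduction G V = G"
    using is_elimination_unique is_elimination_isospectral_reduction[OF G(1) S]
      is_elimination_refl[OF G(1)] V by blast
  with S show ?case by (intro exI[of _ "[V]"]) (simp add: final_reduction_def)
next
  case (Suc n)
  have G: "G \<in> wdigraphs" "finite (verts G)"
    and proper: "\<And>a b. a \<in> verts G \<Longrightarrow> b \<in> verts G \<Longrightarrow> proper_ratfun (weight G a b)"
    using Suc.prems by (auto simp: wdigraphs_pi_iff wdigraphs_def)
  obtain v where v: "v \<in> verts G" "v \<notin> V"
    using Suc.hyps(2) by (metis DiffE card.empty ex_in_conv nat.distinct(1))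
  let ?S = "verts G - {v}"
  have wv: "weight G v v \<noteq> lam" using lam_diff_proper_nonzero[OF proper[OF v(1) v(1)]] by auto
  have "set us \<inter> ?S \<noteq> {}" if "is_nonloop_cycle G us" for us
  proof -
    have us: "2 \<le> length us" "distinct us" "(last us, hd us) \<in> edges G"
      using that by (auto simp: is_nonloop_cycle_def)
    then obtain a b vs where ab: "us = a # b # vs"
      by (cases us; cases "tl us") auto
    \<comment> \<open>The two ends of the cycle are different vertices, so at least one of them is
      not \<open>v\<close>.\<close>
    then have "us \<noteq> []" "hd us \<noteq> last us" using us(2) by (simp_all split: if_splits) auto
    moreover have "hd us \<in> verts G" "last us \<in> verts G" using us(3) G(1) by (auto simp: wdigraphs_def)
    ultimately show ?thesis using hd_in_set[of us] last_in_set[of us] by blast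
  qed
  then have S: "structural_set G ?S"
    using wv Suc.prems v by (auto simp: structural_set_def)
  let ?H = "isospectral_reduction G ?S"
  have H: "is_elimination G ?S ?H" by (rule is_elimination_isospectral_reduction[OF G(1) S])
  then have vH: "verts ?H = ?S" "?H \<in> wdigraphs" by (auto simp: is_elimination_def)
  have "?H \<in> wdigraphs_pi"
    unfolding wdigraphs_pi_iff vH(1) using vH(2) proper v(1)
    by (auto simp: is_elimination_single[OF G(1) H v(1) wv]
        intro!: proper_ratfun_add proper_ratfun_mult proper_ratfun_inverse_lam_diff)
  moreover have "n = card (verts ?H - V)"
  proof -
    have "verts ?H - V = (verts G - V) - {v}" using vH(1) by blast
    then show ?thesis using Suc.hyps(2) v G(2) by simp
  qed
  moreover have "V \<subseteq> verts ?H" using Suc.prems v vH by auto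
  ultimately obtain Ss where Ss: "Ss \<noteq> []" "last Ss = V" "reduction_sequence ?H Ss"
    "BW_Gamma (final_reduction ?H Ss) \<subseteq> BW_Gamma ?H"
    using Suc.hyps(1) Suc.prems(2) by blast
  have "BW_Gamma ?H \<subseteq> BW_Gamma G" by (rule BW_Gamma_elimination_subset[OF G(1) H v(1) wv])
  with Ss S show ?case
    by (intro exI[of _ "?S # Ss"]) (auto simp: final_reduction_def)
qed

theorem theorem5p1:
  fixes G :: "'v wdigraph" and V :: "'v set"
  assumes "G \<in> wdigraphs_pi"
    and "V \<noteq> {}"
    and "V \<subseteq> verts G"
  shows "BW_Gamma (reduction_onto G V) \<subseteq> BW_Gamma G"
proof -
  \<comment> \<open>The inclusion for this one sequence suffices, since all sequences ending in
    \<open>V\<close> have the same final graph.\<close>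
  obtain Ss where "Ss \<noteq> []" "last Ss = V" "reduction_sequence G Ss"
    "BW_Gamma (final_reduction G Ss) \<subseteq> BW_Gamma G"
    using reduction_sequence_exists_BW_Gamma_subset[OF assms] by blast
  moreover have "G \<in> wdigraphs" using assms by (simp add: wdigraphs_pi_iff)
  ultimately show ?thesis using reduction_onto_eqI[of G Ss V] by simp
qed

end
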